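(* Let $p\in[1,\infty)\cup\{\infty\}$ and let $P\subseteq\mathbb{R}^d$ be a finite set of points. There exists a point $c\in\mathbb{R}^d$ such that $|\mathcal{H}^p_{c,v}\cap P|\ge\frac{|P|}{d+1}$ for all $v\in S^{d-1}$.
   Context: For $x\in\mathbb{R}^d$ and $v\in\mathbb{R}^d\setminus\{0\}$, the (limit) $\ell_p$-halfspace is $\mathcal{H}^p_{x,v}=\{z\in\mathbb{R}^d : \|x-z\|_p\le\|x-\epsilon v-z\|_p \text{ for all }\epsilon>0\}$, where $\|\cdot\|_p$ is the $\ell_p$-norm ($\|y\|_\infty=\max_i|y_i|$). $S^{d-1}$ is the Euclidean unit sphere. *)

theory Defs
  imports "HOL-Analysis.Analysis"
begin

definition lp_norm :: "ereal \<Rightarrow> real ^ 'n \<Rightarrow> real" where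
  "lp_norm p y =
     (if p = \<infinity> then infnorm y
      else (\<Sum>i\<in>UNIV. \<bar>y $ i\<bar> powr real_of_ereal p) powr (1 / real_of_ereal p))"

definition lp_halfspace :: "ereal \<Rightarrow> real ^ 'n \<Rightarrow> real ^ 'n \<Rightarrow> (real ^ 'n) set" where
  "lp_halfspace p x v = {z. \<forall>\<epsilon>>0. lp_norm p (x - z) \<le> lp_norm p (x - \<epsilon> *\<^sub>R v - z)}"

end

theory Submission
  imports Defs
begin

text \<open>
  Halfspaces enter only through distance comparisons: \<open>z\<close> fails to lie in the halfspace at \<open>c\<close> in
  direction \<open>v\<close> iff \<open>c - \<epsilon> v\<close> is strictly closer to \<open>z\<close> than \<open>c\<close> for some \<open>\<epsilon> > 0\<close>, and then, by
  convexity of the norm, for all small \<open>\<epsilon> > 0\<close>. As \<open>P\<close> is finite, it suffices to find \<open>c\<close> such that,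
  for each rival \<open>y\<close>, at least \<open>|P|/(d+1)\<close> points of \<open>P\<close> are no closer to \<open>y\<close> than to \<open>c\<close>.

  This is Greenberg's theorem on majority voting in \<open>\<real>\<^sup>d\<close> (the points vote for their nearest
  candidate). Suppose that every candidate has a rival supported by more than \<open>d/(d+1)\<close> of the voters.
  The Fan-Browder fixed point theorem produces a candidate \<open>c\<close> in the convex hull of such rivals of
  \<open>c\<close>. By Caratheodory's theorem \<open>d + 1\<close> of these rivals suffice, so some voter prefers all of them
  to \<open>c\<close>; by convexity this voter prefers \<open>c\<close> to itself. The fixed point theorem needs compactness,
  but since the norm is coercive, a far away rival can be replaced by the origin.
\<close>

section \<open>The Fan-Browder fixed point theorem\<close>

lemma continuous_convex_hull_selection:
  fixes K :: "'a::metric_space set" and U :: "'b::real_normed_vector \<Rightarrow> 'a set"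
  assumes "compact K" and open_U: "\<And>y. y \<in> Y \<Longrightarrow> open (U y)" and "K \<subseteq> (\<Union>y\<in>Y. U y)"
  obtains f where "continuous_on K f" and "\<And>x. x \<in> K \<Longrightarrow> f x \<in> convex hull {y \<in> Y. x \<in> U y}"
proof -
  obtain V where V: "V \<subseteq> Y" "finite V" "K \<subseteq> (\<Union>y\<in>V. U y)"
    using compactE_image[OF assms] by blast
  have cover: "K \<subseteq> \<Union>(U ` V)" and opens: "\<And>W. W \<in> U ` V \<Longrightarrow> open W"
    and locally_finite: "\<And>x. x \<in> K \<Longrightarrow> \<exists>T. open T \<and> x \<in> T \<and> finite {W \<in> U ` V. W \<inter> T \<noteq> {}}"
    using V open_U by (auto intro: exI[of _ UNIV])
  obtain \<phi> :: "'a set \<Rightarrow> 'a \<Rightarrow> real"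
    where \<phi>: "\<And>W. W \<in> U ` V \<Longrightarrow> continuous_on K (\<phi> W) \<and> (\<forall>x\<in>K. 0 \<le> \<phi> W x)"
    and zero: "\<And>x W. \<lbrakk>W \<in> U ` V; x \<in> K; x \<notin> W\<rbrakk> \<Longrightarrow> \<phi> W x = 0"
    and one: "\<And>x. x \<in> K \<Longrightarrow> supp_sum (\<lambda>W. \<phi> W x) (U ` V) = 1"
    by (rule subordinate_partition_of_unity[OF cover opens locally_finite])
      (assumption+, erule that)
  define y where "y = inv_into V U"
  have y: "y W \<in> V" "U (y W) = W" if "W \<in> U ` V" for W
    using that by (auto simp: y_def inv_into_into f_inv_into_f)
  show ?thesis
  proof
    show "continuous_on K (\<lambda>x. \<Sum>W\<in>U ` V. \<phi> W x *\<^sub>R y W)"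
      using \<phi> by (intro continuous_intros) blast
  next
    fix x assume x: "x \<in> K"
    have "(\<Sum>W\<in>U ` V. \<phi> W x *\<^sub>R y W) = supp_sum (\<lambda>W. \<phi> W x *\<^sub>R y W) (U ` V)"
      unfolding supp_sum_def support_on_def using V(2) by (intro sum.mono_neutral_right) auto
    also have "\<dots> \<in> convex hull {y \<in> Y. x \<in> U y}"
    proof (rule convex_supp_sum[OF convex_convex_hull one[OF x]])
      fix W assume W: "W \<in> U ` V"
      have "y W \<in> {y \<in> Y. x \<in> U y}" if "\<phi> W x \<noteq> 0"
        using zero[OF W x] y[OF W] V(1) that by auto
      then show "0 \<le> \<phi> W x \<and> (\<phi> W x = 0 \<or> y W \<in> convex hull {y \<in> Y. x \<in> U y})"
        using \<phi>[OF W] x hull_inc[of "y W"] by metis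
    qed
    finally show "(\<Sum>W\<in>U ` V. \<phi> W x *\<^sub>R y W) \<in> convex hull {y \<in> Y. x \<in> U y}" .
  qed
qed

theorem fan_browder_fixed_point:
  fixes K :: "'a::euclidean_space set"
  assumes K: "compact K" "convex K" "K \<noteq> {}"
    and U: "\<And>y. y \<in> K \<Longrightarrow> open (U y)" "K \<subseteq> (\<Union>y\<in>K. U y)"
  obtains c where "c \<in> K" and "c \<in> convex hull {y \<in> K. c \<in> U y}"
proof -
  obtain f where cont: "continuous_on K f"
    and in_hull: "\<And>x. x \<in> K \<Longrightarrow> f x \<in> convex hull {y \<in> K. x \<in> U y}"
    using continuous_convex_hull_selection[OF K(1) U] by blast
  have "convex hull {y \<in> K. x \<in> U y} \<subseteq> K" for x
    using K(2) by (intro hull_minimal) auto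
  then have "f \<in> K \<rightarrow> K"
    using in_hull by blast
  then obtain c where "c \<in> K" "f c = c"
    using brouwer[OF K cont] by blast
  then show ?thesis
    using in_hull[of c] that by simp
qed

section \<open>Greenberg's majority theorem\<close>

text \<open>Here \<open>f i\<close> is the cost function of voter \<open>i\<close>; ties count for the first candidate.\<close>

definition supporters :: "('i \<Rightarrow> 'a \<Rightarrow> real) \<Rightarrow> 'i set \<Rightarrow> 'a \<Rightarrow> 'a \<Rightarrow> 'i set" where
  "supporters f I x y = {i \<in> I. f i x \<le> f i y}"

lemma open_card_closed_less:
  fixes A :: "'i \<Rightarrow> 'a::topological_space set"
  assumes "finite I" and "\<And>i. i \<in> I \<Longrightarrow> closed (A i)"
  shows "open {x. real (card {i \<in> I. x \<in> A i}) < m}"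
proof (subst open_subopen, rule ballI)
  fix x assume "x \<in> {x. real (card {i \<in> I. x \<in> A i}) < m}"
  then have m: "real (card {i \<in> I. x \<in> A i}) < m" by simp
  let ?T = "\<Inter>i\<in>{i \<in> I. x \<notin> A i}. - A i"
  have "open ?T"
    using assms by (intro open_INT ballI open_Compl) auto
  moreover have "real (card {i \<in> I. y \<in> A i}) < m" if "y \<in> ?T" for y
  proof -
    have "card {i \<in> I. y \<in> A i} \<le> card {i \<in> I. x \<in> A i}"
      using assms(1) that by (intro card_mono) auto
    then show ?thesis using m by simp
  qed
  ultimately show "\<exists>T. open T \<and> x \<in> T \<and> T \<subseteq> {x. real (card {i \<in> I. x \<in> A i}) < m}"
    by (intro exI[of _ ?T]) auto
qed

lemma convex_hull_meets_convex_family: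
  fixes A :: "'i \<Rightarrow> 'a::euclidean_space set"
  assumes "finite I" and conv: "\<And>i. i \<in> I \<Longrightarrow> convex (A i)"
    and few: "\<And>v. v \<in> V \<Longrightarrow> real (card {i \<in> I. v \<notin> A i}) < real (card I) / (real DIM('a) + 1)"
    and "w \<in> convex hull V"
  obtains i where "i \<in> I" and "w \<in> A i"
proof -
  obtain S where S: "finite S" "S \<subseteq> V" "card S \<le> DIM('a) + 1" "w \<in> convex hull S"
    using assms(4) caratheodory[of V] by auto
  have "S \<noteq> {}" using S(4) by auto
  have "real (card (\<Union>v\<in>S. {i \<in> I. v \<notin> A i})) \<le> (\<Sum>v\<in>S. real (card {i \<in> I. v \<notin> A i}))"
    using card_UN_le[OF S(1), of "\<lambda>v. {i \<in> I. v \<notin> A i}"] by (simp flip: of_nat_sum)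
  also have "\<dots> < (\<Sum>v\<in>S. real (card I) / (real DIM('a) + 1))"
    using S few \<open>S \<noteq> {}\<close> by (intro sum_strict_mono) auto
  also have "\<dots> = real (card S) * (real (card I) / (real DIM('a) + 1))" by simp
  also have "\<dots> \<le> (real DIM('a) + 1) * (real (card I) / (real DIM('a) + 1))"
    using S(3) by (intro mult_right_mono) auto
  also have "\<dots> = real (card I)" by (simp add: add_nonneg_eq_0_iff del: of_nat_Suc)
  finally have "(\<Union>v\<in>S. {i \<in> I. v \<notin> A i}) \<noteq> I" by auto
  then obtain i where i: "i \<in> I" "S \<subseteq> A i" by auto
  then have "convex hull S \<subseteq> A i"
    by (intro hull_minimal conv)
  then show ?thesis using that i(1) S(4) by auto
qed

theorem greenberg_majority:
  fixes f :: "'i \<Rightarrow> 'a::euclidean_space \<Rightarrow> real"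
  assumes fin: "finite I"
    and cont: "\<And>i. i \<in> I \<Longrightarrow> continuous_on UNIV (f i)"
    and quasiconvex: "\<And>i r. i \<in> I \<Longrightarrow> convex {x. f i x < r}"
    and coercive: "\<And>i. i \<in> I \<Longrightarrow> filterlim (f i) at_top at_infinity"
  shows "\<exists>c. \<forall>y. real (card I) / (real DIM('a) + 1) \<le> real (card (supporters f I c y))"
proof (rule ccontr)
  define m where "m = real (card I) / (real DIM('a) + 1)"
  define U where "U y = {c. real (card (supporters f I c y)) < m}" for y
  assume "\<not> ?thesis"
  then have beaten: "\<exists>y. c \<in> U y" for c
    by (simp add: U_def m_def not_le)
  have "\<forall>\<^sub>F y in at_infinity. \<forall>i\<in>I. f i 0 \<le> f i y"
    using fin coercive by (auto simp: eventually_ball_finite_distrib filterlim_at_top)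
  then obtain b where b: "b > 0" and far: "\<And>y i. b \<le> norm y \<Longrightarrow> i \<in> I \<Longrightarrow> f i 0 \<le> f i y"
    by (auto simp: eventually_at_infinity_pos)
  have U_far: "U y \<subseteq> U 0" if "b \<le> norm y" for y
  proof
    fix c assume "c \<in> U y"
    moreover have "card (supporters f I c 0) \<le> card (supporters f I c y)"
      using fin far[OF that] by (intro card_mono) (auto simp: supporters_def intro: order_trans)
    ultimately show "c \<in> U 0" by (simp add: U_def)
  qed
  have "c \<in> (\<Union>y\<in>cball 0 b. U y)" for c
  proof -
    obtain y where "c \<in> U y" using beaten by blast
    then show ?thesis
      using U_far[of y] b by (cases "norm y \<le> b") auto
  qed
  moreover have "open (U y)" for y
    unfolding U_def supporters_def
    using open_card_closed_less[OF fin, of "\<lambda>i. {c. f i c \<le> f i y}"] cont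
    by (simp add: closed_Collect_le)
  ultimately obtain c where in_hull: "c \<in> convex hull {y \<in> cball 0 b. c \<in> U y}"
    using fan_browder_fixed_point[of "cball 0 b" U] b
    by (metis cball_eq_empty compact_cball convex_cball not_less_iff_gr_or_eq subsetI)
  have "real (card {i \<in> I. y \<notin> {x. f i x < f i c}}) < m" if "y \<in> {y \<in> cball 0 b. c \<in> U y}" for y
    using that by (simp add: U_def supporters_def not_less)
  then obtain i where "i \<in> I" "c \<in> {x. f i x < f i c}"
    using convex_hull_meets_convex_family[OF fin, of "\<lambda>i. {x. f i x < f i c}", OF quasiconvex _ in_hull]
    unfolding m_def by blast
  then show False by simp
qed

section \<open>Centerpoints for coercive convex functions\<close>

lemma convex_on_imp_convex_strict_sublevel:
  assumes "convex_on S f"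
  shows "convex {x \<in> S. f x < r}"
proof (rule convexI)
  fix x y and u v :: real
  assume xy: "x \<in> {x \<in> S. f x < r}" "y \<in> {x \<in> S. f x < r}" and uv: "0 \<le> u" "0 \<le> v" "u + v = 1"
  have "f (u *\<^sub>R x + v *\<^sub>R y) \<le> u * f x + v * f y"
    using assms xy uv by (auto simp: convex_on_def)
  also have "\<dots> < r"
    using xy uv by (intro convex_bound_lt) auto
  finally show "u *\<^sub>R x + v *\<^sub>R y \<in> {x \<in> S. f x < r}"
    using convexD[OF convex_on_imp_convex[OF assms]] xy uv by auto
qed

lemma convex_on_translation:
  assumes "convex_on UNIV N"
  shows "convex_on UNIV (\<lambda>x. N (x - z))"
proof (rule convex_onI)
  fix t :: real and x y :: 'a
  assume "0 < t" "t < 1"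
  moreover have "(1 - t) *\<^sub>R x + t *\<^sub>R y - z = (1 - t) *\<^sub>R (x - z) + t *\<^sub>R (y - z)"
    by (simp add: algebra_simps)
  ultimately show "N ((1 - t) *\<^sub>R x + t *\<^sub>R y - z) \<le> (1 - t) * N (x - z) + t * N (y - z)"
    using convex_onD[OF assms] by simp
qed simp

lemma convex_on_eventually_descent:
  fixes x v :: "'a::real_vector"
  assumes "convex_on UNIV N" and "0 < e" and "N (x - e *\<^sub>R v) < N x"
  shows "\<forall>\<^sub>F d in at_right 0. N (x - d *\<^sub>R v) < N x"
proof -
  have "N (x - d *\<^sub>R v) < N x" if d: "0 < d" "d < e" for d
  proof -
    let ?t = "d / e"
    have t: "0 < ?t" "?t \<le> 1" using d by auto
    have "x - d *\<^sub>R v = (1 - ?t) *\<^sub>R x + ?t *\<^sub>R (x - e *\<^sub>R v)"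
      using d by (simp add: algebra_simps)
    then have "N (x - d *\<^sub>R v) \<le> (1 - ?t) * N x + ?t * N (x - e *\<^sub>R v)"
      using convex_onD[OF assms(1), of ?t x "x - e *\<^sub>R v"] t by simp
    also have "\<dots> < (1 - ?t) * N x + ?t * N x"
      using t(1) assms(3) by (intro add_strict_left_mono mult_strict_left_mono)
    finally show ?thesis by (simp add: algebra_simps)
  qed
  then show ?thesis
    using assms(2) by (auto simp: eventually_at_right)
qed

definition limit_halfspace :: "('a::real_vector \<Rightarrow> real) \<Rightarrow> 'a \<Rightarrow> 'a \<Rightarrow> 'a set" where
  "limit_halfspace N c v = {z. \<forall>\<epsilon>>0. N (c - z) \<le> N (c - \<epsilon> *\<^sub>R v - z)}"

lemma supporters_subset_limit_halfspace:
  assumes "convex_on UNIV N" and "finite P"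
  obtains y where "supporters (\<lambda>z x. N (x - z)) P c y \<subseteq> limit_halfspace N c v \<inter> P"
proof -
  have rearrange: "c - \<epsilon> *\<^sub>R v - z = c - z - \<epsilon> *\<^sub>R v" for \<epsilon> z
    by (simp add: algebra_simps)
  have "\<forall>\<^sub>F d in at_right 0. z \<notin> limit_halfspace N c v \<longrightarrow> N (c - z - d *\<^sub>R v) < N (c - z)" for z
    using convex_on_eventually_descent[OF assms(1), of _ "c - z" v]
    by (auto simp: limit_halfspace_def rearrange not_le)
  then have "\<forall>\<^sub>F d in at_right 0.
      \<forall>z\<in>P. z \<notin> limit_halfspace N c v \<longrightarrow> N (c - z - d *\<^sub>R v) < N (c - z)"
    using assms(2) by (intro eventually_ball_finite) auto
  then obtain d :: real
    where "\<forall>z\<in>P. z \<notin> limit_halfspace N c v \<longrightarrow> N (c - z - d *\<^sub>R v) < N (c - z)"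
    using eventually_happens'[OF trivial_limit_at_right_real] by blast
  then show ?thesis
    by (intro that[of "c - d *\<^sub>R v"]) (fastforce simp: supporters_def rearrange)
qed

theorem centerpoint_coercive_convex:
  fixes N :: "'a::euclidean_space \<Rightarrow> real"
  assumes conv: "convex_on UNIV N" and coercive: "filterlim N at_top at_infinity"
    and fin: "finite P"
  shows "\<exists>c. \<forall>v. real (card P) / (real DIM('a) + 1) \<le> real (card (limit_halfspace N c v \<inter> P))"
proof -
  have "continuous_on UNIV (\<lambda>x. N (x - z))" for z
    by (rule convex_on_continuous[OF open_UNIV convex_on_translation[OF conv]])
  moreover have "convex {x. N (x - z) < r}" for z r
    using convex_on_imp_convex_strict_sublevel[OF convex_on_translation[OF conv]] by simp
  moreover have "filterlim (\<lambda>x. N (x - z)) at_top at_infinity" for z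
  proof -
    have "filterlim (\<lambda>x. x + - z) at_infinity at_infinity"
      by (rule tendsto_add_filterlim_at_infinity'[OF filterlim_ident tendsto_const])
    then show ?thesis
      using filterlim_compose[OF coercive] by simp
  qed
  ultimately obtain c where many_supporters:
    "\<And>y. real (card P) / (real DIM('a) + 1) \<le> real (card (supporters (\<lambda>z x. N (x - z)) P c y))"
    using greenberg_majority[OF fin, of "\<lambda>z x. N (x - z)"] by blast
  have "real (card P) / (real DIM('a) + 1) \<le> real (card (limit_halfspace N c v \<inter> P))" for v
  proof -
    obtain y where "supporters (\<lambda>z x. N (x - z)) P c y \<subseteq> limit_halfspace N c v \<inter> P"
      using supporters_subset_limit_halfspace[OF conv fin] by blast
    then have "card (supporters (\<lambda>z x. N (x - z)) P c y) \<le> card (limit_halfspace N c v \<inter> P)"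
      using fin by (intro card_mono) auto
    then show ?thesis using many_supporters[of y] by linarith
  qed
  then show ?thesis by blast
qed

section \<open>The \<open>\<ell>\<^sub>p\<close>-norm is convex and coercive\<close>

lemma convex_on_sublinear:
  fixes N :: "'a::real_vector \<Rightarrow> real"
  assumes "\<And>x y. N (x + y) \<le> N x + N y" and "\<And>t x. 0 \<le> t \<Longrightarrow> N (t *\<^sub>R x) = t * N x"
  shows "convex_on UNIV N"
proof (rule convex_onI)
  fix t :: real and x y :: 'a
  assume "0 < t" "t < 1"
  then show "N ((1 - t) *\<^sub>R x + t *\<^sub>R y) \<le> (1 - t) * N x + t * N y"
    using assms(1)[of "(1 - t) *\<^sub>R x" "t *\<^sub>R y"] by (simp add: assms(2))
qed simp

lemma subadditive_if_convex_unit_ball: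
  fixes N :: "'a::real_vector \<Rightarrow> real"
  assumes nonneg: "\<And>x. 0 \<le> N x" and scale: "\<And>t x. 0 \<le> t \<Longrightarrow> N (t *\<^sub>R x) = t * N x"
    and ball: "convex {x. N x < 1}"
  shows "N (x + y) \<le> N x + N y"
proof (rule field_le_epsilon)
  fix e :: real assume "0 < e"
  define a b where "a = N x + e / 2" and "b = N y + e / 2"
  have a: "0 < a" "N x < a" and b: "0 < b" "N y < b"
    using \<open>0 < e\<close> nonneg[of x] nonneg[of y] by (simp_all add: a_def b_def)
  have "(a / (a + b)) *\<^sub>R ((1 / a) *\<^sub>R x) + (b / (a + b)) *\<^sub>R ((1 / b) *\<^sub>R y) \<in> {x. N x < 1}"
    using a b by (intro convexD[OF ball]) (auto simp: scale simp flip: add_divide_distrib)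
  moreover have "(a / (a + b)) *\<^sub>R ((1 / a) *\<^sub>R x) + (b / (a + b)) *\<^sub>R ((1 / b) *\<^sub>R y)
      = (1 / (a + b)) *\<^sub>R (x + y)"
    using a b by (simp add: scaleR_add_right)
  ultimately have "N (x + y) < a + b"
    using a b by (simp add: scale)
  then show "N (x + y) \<le> N x + N y + e"
    by (simp add: a_def b_def)
qed

lemma convex_on_compose_mono_on:
  assumes f: "convex_on S f" and g: "convex_on T g" "mono_on T g" and "f ` S \<subseteq> T"
  shows "convex_on S (\<lambda>x. g (f x))"
  unfolding convex_on_def
proof (intro conjI convex_on_imp_convex[OF f] ballI allI impI)
  fix x y and u v :: real
  assume xy: "x \<in> S" "y \<in> S" and uv: "0 \<le> u" "0 \<le> v" "u + v = 1"
  have T: "f x \<in> T" "f y \<in> T" using xy assms(4) by auto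
  have "u *\<^sub>R x + v *\<^sub>R y \<in> S"
    using convexD[OF convex_on_imp_convex[OF f]] xy uv by auto
  moreover have "u * f x + v * f y \<in> T"
    using convexD[OF convex_on_imp_convex[OF g(1)] T uv] by simp
  moreover have "f (u *\<^sub>R x + v *\<^sub>R y) \<le> u * f x + v * f y"
    using f xy uv by (auto simp: convex_on_def)
  ultimately have "g (f (u *\<^sub>R x + v *\<^sub>R y)) \<le> g (u * f x + v * f y)"
    using g(2) assms(4) by (auto intro: mono_onD)
  also have "\<dots> \<le> u * g (f x) + v * g (f y)"
    using g(1) T uv by (auto simp: convex_on_def)
  finally show "g (f (u *\<^sub>R x + v *\<^sub>R y)) \<le> u * g (f x) + v * g (f y)" .
qed

lemma convex_on_powr_nonneg:
  fixes q :: real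
  assumes "1 \<le> q"
  shows "convex_on {0..} (\<lambda>x. x powr q)"
proof (rule convex_on_linorderI)
  fix t x y :: real
  assume t: "0 < t" "t < 1" and xy: "x \<in> {0..}" "y \<in> {0..}" "x < y"
  show "((1 - t) *\<^sub>R x + t *\<^sub>R y) powr q \<le> (1 - t) * x powr q + t * y powr q"
  proof (cases "x = 0")
    case True
    have "t powr q \<le> t powr 1" using t assms by (intro powr_mono') auto
    then show ?thesis using True t xy by (simp add: powr_mult mult_right_mono)
  next
    case False
    then show ?thesis using convex_onD[OF powr_convex[OF assms], of t x y] t xy by simp
  qed
qed simp

lemma convex_on_abs_component: "convex_on UNIV (\<lambda>y::real^'n. \<bar>y $ i\<bar>)"
  by (rule convex_on_sublinear) (simp_all add: abs_mult)

lemma convex_on_finite_sum: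
  assumes "finite I" and "convex S" and "\<And>i. i \<in> I \<Longrightarrow> convex_on S (f i)"
  shows "convex_on S (\<lambda>x. \<Sum>i\<in>I. f i x)"
  using assms(1,3) by (induction I) (auto simp: convex_on_const assms(2) intro: convex_on_add)

lemma convex_on_sum_abs_powr:
  fixes q :: real
  assumes "1 \<le> q"
  shows "convex_on UNIV (\<lambda>y::real^'n. \<Sum>i\<in>UNIV. \<bar>y $ i\<bar> powr q)"
proof (intro convex_on_finite_sum)
  have "mono_on {0..} (\<lambda>x. x powr q)"
    using assms by (intro mono_onI powr_mono2) auto
  then show "convex_on UNIV (\<lambda>y::real^'n. \<bar>y $ i\<bar> powr q)" for i
    by (intro convex_on_compose_mono_on[OF convex_on_abs_component convex_on_powr_nonneg[OF assms]]) auto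
qed auto

lemma lp_norm_infinity: "lp_norm \<infinity> y = infnorm y"
  by (simp add: lp_norm_def)

lemma lp_norm_ereal: "lp_norm (ereal q) y = (\<Sum>i\<in>UNIV. \<bar>y $ i\<bar> powr q) powr (1 / q)"
  by (simp add: lp_norm_def)

lemma lp_norm_nonneg: "0 \<le> lp_norm p y"
  by (simp add: lp_norm_def infnorm_pos_le)

lemma ereal_ge_one_cases:
  fixes p :: ereal
  assumes "1 \<le> p"
  obtains (infinite) "p = \<infinity>" | (finite) q where "p = ereal q" "1 \<le> q"
  using assms by (cases p) auto

lemma lp_norm_scaleR:
  assumes "1 \<le> p"
  shows "lp_norm p (t *\<^sub>R y) = \<bar>t\<bar> * lp_norm p y"
  using assms
proof (cases rule: ereal_ge_one_cases)
  case infinite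
  then show ?thesis by (simp add: lp_norm_infinity infnorm_mul)
next
  case (finite q)
  have "(\<Sum>i\<in>UNIV. \<bar>(t *\<^sub>R y) $ i\<bar> powr q) = \<bar>t\<bar> powr q * (\<Sum>i\<in>UNIV. \<bar>y $ i\<bar> powr q)"
    by (simp add: abs_mult powr_mult sum_distrib_left)
  then show ?thesis
    using finite by (simp add: lp_norm_ereal powr_mult powr_powr sum_nonneg)
qed

lemma component_le_lp_norm:
  assumes "1 \<le> p"
  shows "\<bar>y $ i\<bar> \<le> lp_norm p y"
  using assms
proof (cases rule: ereal_ge_one_cases)
  case infinite
  then show ?thesis by (simp add: lp_norm_infinity component_le_infnorm_cart)
next
  case (finite q)
  have "\<bar>y $ i\<bar> = (\<bar>y $ i\<bar> powr q) powr (1 / q)"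
    using finite by (simp add: powr_powr)
  also have "\<dots> \<le> (\<Sum>i\<in>UNIV. \<bar>y $ i\<bar> powr q) powr (1 / q)"
    using finite by (intro powr_mono2 member_le_sum) auto
  finally show ?thesis
    using finite by (simp add: lp_norm_ereal)
qed

lemma lp_norm_triangle:
  fixes x y :: "real^'n"
  assumes "1 \<le> p"
  shows "lp_norm p (x + y) \<le> lp_norm p x + lp_norm p y"
  using assms
proof (cases rule: ereal_ge_one_cases)
  case infinite
  then show ?thesis by (simp add: lp_norm_infinity infnorm_triangle)
next
  case (finite q)
  have "lp_norm p z < 1 \<longleftrightarrow> (\<Sum>i\<in>UNIV. \<bar>z $ i\<bar> powr q) < 1" for z :: "real^'n"
  proof -
    have "0 \<le> (\<Sum>i\<in>UNIV. \<bar>z $ i\<bar> powr q)" by (simp add: sum_nonneg)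
    then show ?thesis
      using finite powr_mono2[of "1 / q" 1 "\<Sum>i\<in>UNIV. \<bar>z $ i\<bar> powr q"]
        powr_less_mono2[of "1 / q" "\<Sum>i\<in>UNIV. \<bar>z $ i\<bar> powr q" 1]
      by (force simp: lp_norm_ereal)
  qed
  then have "convex {z :: real^'n. lp_norm p z < 1}"
    using convex_on_imp_convex_strict_sublevel[OF convex_on_sum_abs_powr[OF finite(2)], of 1] by simp
  then show ?thesis
    using assms by (intro subadditive_if_convex_unit_ball lp_norm_nonneg) (simp_all add: lp_norm_scaleR)
qed

lemma convex_on_lp_norm:
  assumes "1 \<le> p"
  shows "convex_on UNIV (lp_norm p :: real^'n \<Rightarrow> real)"
  using assms by (intro convex_on_sublinear lp_norm_triangle) (simp_all add: lp_norm_scaleR)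

lemma filterlim_lp_norm_at_top:
  assumes "1 \<le> p"
  shows "filterlim (lp_norm p :: real^'n \<Rightarrow> real) at_top at_infinity"
proof (rule filterlim_at_top_mono)
  show "filterlim (\<lambda>y::real^'n. inverse (real CARD('n)) * norm y) at_top at_infinity"
    by (intro filterlim_tendsto_pos_mult_at_top[OF tendsto_const] filterlim_norm_at_top) simp
  have "norm y \<le> real CARD('n) * lp_norm p y" for y :: "real^'n"
    using norm_le_l1_cart[of y] sum_bounded_above[of UNIV "\<lambda>i. \<bar>y $ i\<bar>", OF component_le_lp_norm[OF assms]]
    by simp
  then show "\<forall>\<^sub>F y::real^'n in at_infinity. inverse (real CARD('n)) * norm y \<le> lp_norm p y"
    by (intro always_eventually) (simp add: field_simps)
qed

theorem theorem3p18:
  fixes p :: ereal and P :: "(real ^ 'n) set"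
  assumes "1 \<le> p" and "finite P"
  shows "\<exists>c :: real ^ 'n. \<forall>v \<in> sphere 0 1.
           real (card (lp_halfspace p c v \<inter> P)) \<ge> real (card P) / (real CARD('n) + 1)"
proof -
  have "lp_halfspace p = limit_halfspace (lp_norm p :: real^'n \<Rightarrow> real)"
    by (intro ext) (simp add: lp_halfspace_def limit_halfspace_def)
  moreover have "\<exists>c :: real^'n. \<forall>v. real (card P) / (real CARD('n) + 1)
      \<le> real (card (limit_halfspace (lp_norm p) c v \<inter> P))"
    using centerpoint_coercive_convex[OF convex_on_lp_norm filterlim_lp_norm_at_top] assms by simp
  ultimately show ?thesis by auto
qed

end
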